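(* Let $G=\mathrm{Cay}(\Gamma,S)$ be a Cayley graph where $\Gamma$ is a finite abelian group. For any Laplacian eigenvalue $\lambda>0$ of $G$, with respect to the group of automorphisms of $G$ induced by $\Gamma$ (acting by translations), the eigenspace $\mathcal{E}_\lambda$ decomposes into isotypic components of multiplicity $1$ (i.e. each real irreducible $\Gamma$-representation occurs in $\mathcal{E}_\lambda$ with multiplicity at most $1$). Thus, $\ell_\Gamma(\mathcal{E}_\lambda)=\{\ell_\Gamma(\varphi):\varphi\in\mathcal{E}_\lambda\}$ is a polyhedral cone.
   Context: For a finite group $\Gamma$ and a generating set $S\subseteq\Gamma$ with $s\in S\Rightarrow s^{-1}\in S$ and not containing the identity, $\mathrm{Cay}(\Gamma,S)$ is the connected undirected graph $(V,E)$ with $V=\Gamma$ and edges $\{g,gs\}$ for $g\in\Gamma$, $s\in S$. Each $h\in\Gamma$ acts on it by the automorphism $g\mapsto hg$, and hence on $\mathbb{R}^V$ by $(h\cdot\varphi)(g)=\varphi(h^{-1}g)$. The Laplacian $L$ of $G$ is the symmetric matrix with $\langle\varphi,L\varphi\rangle=\sum_{uv\in E}(\varphi(u)-\varphi(v))^2$ for $\varphi\in\mathbb{R}^V$, and $\mathcal{E}_\lambda=\{\varphi\in\mathbb{R}^V:L\varphi=\lambda\varphi\}$, which is a real $\Gamma$-subrepresentation of $\mathbb{R}^V$. Let $\mathcal{O}_1,\dots,\mathcal{O}_s$ be the orbits of $\Gamma$ on $E$. For $\varphi:V\to\mathbb{R}$, $\ell_\Gamma(\varphi)=\big(\sum_{uv\in\mathcal{O}_i}(\varphi(u)-\varphi(v))^2\big)_{i=1}^s\in\mathbb{R}^s$.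 A polyhedral cone is the set of all nonnegative linear combinations of finitely many vectors. *)

theory Defs
  imports
    "HOL-Analysis.Analysis"
    "HOL-Algebra.Generated_Groups"
    "HOL-Algebra.Group_Action"
begin

section \<open>Cayley graphs and their Laplacian\<close>

text \<open>
  The vertex set \<open>V\<close> is a finite type \<open>'a\<close>, so \<open>\<real>\<^sup>V\<close> is \<open>real ^ 'a\<close>; a group with vertex set \<open>V\<close> is
  a structure with carrier \<open>UNIV :: 'a set\<close>. Edges are unordered pairs, i.e. sets \<open>{u, v}\<close>.
\<close>

definition cay_edges :: "('a, 'm) monoid_scheme \<Rightarrow> 'a set \<Rightarrow> 'a set set"
  where "cay_edges \<Gamma> S = {{g, g \<otimes>\<^bsub>\<Gamma>\<^esub> s} | g s. g \<in> carrier \<Gamma> \<and> s \<in> S}"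

definition edge_orbits :: "('a, 'm) monoid_scheme \<Rightarrow> 'a set \<Rightarrow> 'a set set set"
  where "edge_orbits \<Gamma> S = orbits \<Gamma> (cay_edges \<Gamma> S) (\<lambda>h e. (\<lambda>g. h \<otimes>\<^bsub>\<Gamma>\<^esub> g) ` e)"

definition translate :: "('a::finite, 'm) monoid_scheme \<Rightarrow> 'a \<Rightarrow> real ^ 'a \<Rightarrow> real ^ 'a"
  where "translate \<Gamma> h \<phi> = (\<chi> g. \<phi> $ (inv\<^bsub>\<Gamma>\<^esub> h \<otimes>\<^bsub>\<Gamma>\<^esub> g))"

definition edge_sq :: "real ^ 'a \<Rightarrow> 'a set \<Rightarrow> real"
  where "edge_sq \<phi> e = (THE r. \<exists>u v. e = {u, v} \<and> r = (\<phi> $ u - \<phi> $ v)\<^sup>2)"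

lemma edge_sq_eq: "edge_sq \<phi> {u, v} = (\<phi> $ u - \<phi> $ v)\<^sup>2"
  unfolding edge_sq_def
  by (rule the_equality) (auto simp: doubleton_eq_iff power2_commute)

definition laplacian :: "'a set set \<Rightarrow> real ^ 'a ^ 'a::finite"
  where "laplacian E =
    (THE L. transpose L = L \<and> (\<forall>\<phi>. \<phi> \<bullet> (L *v \<phi>) = (\<Sum>e\<in>E. edge_sq \<phi> e)))"

lemma sym_matrix_eqI:
  fixes A B :: "real ^ 'a ^ 'a::finite"
  assumes A: "transpose A = A" and B: "transpose B = B"
    and q: "\<And>\<phi>. \<phi> \<bullet> (A *v \<phi>) = \<phi> \<bullet> (B *v \<phi>)"
  shows "A = B"
proof -
  have ent: "axis i 1 \<bullet> (M *v axis j 1) = M $ i $ j" for i j and M :: "real ^ 'a ^ 'a"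
    by (simp add: inner_axis' matrix_vector_mult_basis column_def)
  have sym: "M $ i $ j = M $ j $ i" if "transpose M = M" for i j and M :: "real ^ 'a ^ 'a"
    using that by (metis (mono_tags) transpose_def vec_lambda_beta)
  have "A $ i $ j = B $ i $ j" for i j
    using q[of "axis i 1 + axis j 1"] q[of "axis i 1"] q[of "axis j 1"]
      sym[OF A, of i j] sym[OF B, of i j]
    by (simp add: inner_add_left inner_add_right matrix_vector_right_distrib ent)
  thus ?thesis by (simp add: vec_eq_iff)
qed

lemma laplacian_ex1:
  fixes E :: "'a::finite set set"
  assumes E: "\<And>e. e \<in> E \<Longrightarrow> \<exists>u v. e = {u, v}"
  shows "\<exists>!L. transpose L = L \<and> (\<forall>\<phi>. \<phi> \<bullet> (L *v \<phi>) = (\<Sum>e\<in>E. edge_sq \<phi> e))"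
proof -
  obtain a b where ab: "\<And>e. e \<in> E \<Longrightarrow> e = {a e, b e}"
    using E by metis
  define d where "d e = (axis (a e) 1 - axis (b e) 1 :: real ^ 'a)" for e
  define L :: "real ^ 'a ^ 'a" where "L = (\<chi> i j. \<Sum>e\<in>E. d e $ i * d e $ j)"
  have d: "\<phi> \<bullet> d e = \<phi> $ a e - \<phi> $ b e" for e \<phi>
    by (simp add: d_def inner_diff_right inner_axis)
  have "L *v \<phi> = (\<Sum>e\<in>E. (\<phi> \<bullet> d e) *\<^sub>R d e)" for \<phi>
  proof -
    have "(L *v \<phi>) $ i = (\<Sum>e\<in>E. (\<phi> \<bullet> d e) *\<^sub>R d e) $ i" for i
    proof -
      have "(L *v \<phi>) $ i = (\<Sum>j\<in>UNIV. \<Sum>e\<in>E. d e $ i * d e $ j * \<phi> $ j)"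
        by (simp add: L_def matrix_vector_mult_def sum_distrib_right)
      also have "\<dots> = (\<Sum>e\<in>E. \<Sum>j\<in>UNIV. d e $ i * d e $ j * \<phi> $ j)"
        by (rule sum.swap)
      also have "\<dots> = (\<Sum>e\<in>E. (\<phi> \<bullet> d e) *\<^sub>R d e) $ i"
        by (simp add: inner_vec_def sum_distrib_left mult_ac)
      finally show ?thesis .
    qed
    thus ?thesis by (simp add: vec_eq_iff)
  qed
  hence "\<phi> \<bullet> (L *v \<phi>) = (\<Sum>e\<in>E. edge_sq \<phi> e)" for \<phi>
  proof -
    have "edge_sq \<phi> e = (\<phi> \<bullet> d e)\<^sup>2" if "e \<in> E" for e
      using edge_sq_eq[of \<phi> "a e" "b e"] ab[OF that] d by metis
    with \<open>\<And>\<phi>. L *v \<phi> = _\<close> show ?thesis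
      by (simp add: inner_sum_right power2_eq_square)
  qed
  moreover have "transpose L = L"
    by (simp add: transpose_def L_def mult.commute)
  ultimately show ?thesis
    by (intro ex1I[of _ L]) (auto intro: sym_matrix_eqI)
qed

lemma laplacian_cay:
  fixes \<Gamma> :: "('a::finite, 'm) monoid_scheme"
  shows "transpose (laplacian (cay_edges \<Gamma> S)) = laplacian (cay_edges \<Gamma> S)"
    and "\<phi> \<bullet> (laplacian (cay_edges \<Gamma> S) *v \<phi>) = (\<Sum>e\<in>cay_edges \<Gamma> S. edge_sq \<phi> e)"
proof -
  have "\<exists>u v. e = {u, v}" if "e \<in> cay_edges \<Gamma> S" for e
    using that by (auto simp: cay_edges_def)
  from theI'[OF laplacian_ex1[OF this]]
  show "transpose (laplacian (cay_edges \<Gamma> S)) = laplacian (cay_edges \<Gamma> S)"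
    and "\<phi> \<bullet> (laplacian (cay_edges \<Gamma> S) *v \<phi>) = (\<Sum>e\<in>cay_edges \<Gamma> S. edge_sq \<phi> e)"
    unfolding laplacian_def by blast+
qed

definition eigenspace :: "real ^ 'a ^ 'a::finite \<Rightarrow> real \<Rightarrow> (real ^ 'a) set"
  where "eigenspace L l = {\<phi>. L *v \<phi> = l *\<^sub>R \<phi>}"

definition is_eigenvalue :: "real ^ 'a ^ 'a::finite \<Rightarrow> real \<Rightarrow> bool"
  where "is_eigenvalue L l \<longleftrightarrow> (\<exists>\<phi>. \<phi> \<noteq> 0 \<and> L *v \<phi> = l *\<^sub>R \<phi>)"

text \<open>
  The target \<open>\<real>\<^sup>s\<close> has one coordinate per edge orbit. It is realised as the coordinate subspace of
  \<open>real ^ ('a set set)\<close> spanned by the coordinates that are edge orbits; all others are \<open>0\<close>.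
\<close>

definition ell :: "('a::finite, 'm) monoid_scheme \<Rightarrow> 'a set \<Rightarrow> real ^ 'a \<Rightarrow> real ^ ('a set set)"
  where "ell \<Gamma> S \<phi> = (\<chi> A. if A \<in> edge_orbits \<Gamma> S then \<Sum>e\<in>A. edge_sq \<phi> e else 0)"

definition polyhedral_cone :: "'v::real_vector set \<Rightarrow> bool"
  where "polyhedral_cone C \<longleftrightarrow>
    (\<exists>F. finite F \<and> C = {\<Sum>v\<in>F. c v *\<^sub>R v | c. \<forall>v\<in>F. 0 \<le> c v})"


section \<open>Real representations on subspaces\<close>

text \<open>
  A representation is given by a subspace \<open>W\<close> of a real vector space and maps \<open>\<rho> g\<close>,
  of which only the restrictions to \<open>W\<close> (for \<open>g\<close> in the carrier) are relevant.
\<close>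

definition linear_on :: "'v::real_vector set \<Rightarrow> ('v \<Rightarrow> 'w::real_vector) \<Rightarrow> bool"
  where "linear_on W f \<longleftrightarrow>
    (\<forall>x\<in>W. \<forall>y\<in>W. f (x + y) = f x + f y) \<and> (\<forall>c. \<forall>x\<in>W. f (c *\<^sub>R x) = c *\<^sub>R f x)"

definition real_rep ::
  "('g, 'm) monoid_scheme \<Rightarrow> ('g \<Rightarrow> 'v \<Rightarrow> 'v) \<Rightarrow> 'v::real_vector set \<Rightarrow> bool"
  where "real_rep \<Gamma> \<rho> W \<longleftrightarrow>
    subspace W \<and>
    (\<forall>g\<in>carrier \<Gamma>. linear_on W (\<rho> g) \<and> \<rho> g ` W \<subseteq> W) \<and>
    (\<forall>x\<in>W. \<rho> \<one>\<^bsub>\<Gamma>\<^esub> x = x) \<and>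
    (\<forall>g\<in>carrier \<Gamma>. \<forall>h\<in>carrier \<Gamma>. \<forall>x\<in>W. \<rho> (g \<otimes>\<^bsub>\<Gamma>\<^esub> h) x = \<rho> g (\<rho> h x))"

definition subrep ::
  "('g, 'm) monoid_scheme \<Rightarrow> ('g \<Rightarrow> 'v \<Rightarrow> 'v) \<Rightarrow> 'v::real_vector set \<Rightarrow> 'v set \<Rightarrow> bool"
  where "subrep \<Gamma> \<rho> W X \<longleftrightarrow> subspace X \<and> X \<subseteq> W \<and> (\<forall>g\<in>carrier \<Gamma>. \<rho> g ` X \<subseteq> X)"

definition irreducible_rep ::
  "('g, 'm) monoid_scheme \<Rightarrow> ('g \<Rightarrow> 'v \<Rightarrow> 'v) \<Rightarrow> 'v::real_vector set \<Rightarrow> bool"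
  where "irreducible_rep \<Gamma> \<rho> W \<longleftrightarrow>
    real_rep \<Gamma> \<rho> W \<and> W \<noteq> {0} \<and> (\<forall>X. subrep \<Gamma> \<rho> W X \<longrightarrow> X = {0} \<or> X = W)"

definition rep_iso ::
  "('g, 'm) monoid_scheme \<Rightarrow> ('g \<Rightarrow> 'v \<Rightarrow> 'v) \<Rightarrow> 'v::real_vector set \<Rightarrow>
    ('g \<Rightarrow> 'w \<Rightarrow> 'w) \<Rightarrow> 'w::real_vector set \<Rightarrow> bool"
  where "rep_iso \<Gamma> \<rho> U \<sigma> W \<longleftrightarrow>
    (\<exists>f. linear_on U f \<and> bij_betw f U W \<and> (\<forall>g\<in>carrier \<Gamma>. \<forall>x\<in>U. f (\<rho> g x) = \<sigma> g (f x)))"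

text \<open>
  Internal direct sum: every element of \<open>U\<close> is in exactly one way a sum of elements of the
  members of \<open>D\<close>, one from each.
\<close>

definition is_direct_sum :: "'v::real_vector set \<Rightarrow> 'v set set \<Rightarrow> bool"
  where "is_direct_sum U D \<longleftrightarrow>
    finite D \<and> (\<forall>X\<in>D. subspace X) \<and> bij_betw (\<lambda>f. \<Sum>X\<in>D. f X) (\<Pi>\<^sub>E X\<in>D. X) U"

definition irreducible_decomposition ::
  "('g, 'm) monoid_scheme \<Rightarrow> ('g \<Rightarrow> 'v \<Rightarrow> 'v) \<Rightarrow> 'v::real_vector set \<Rightarrow> 'v set set \<Rightarrow> bool"
  where "irreducible_decomposition \<Gamma> \<rho> U D \<longleftrightarrow>
    is_direct_sum U D \<and> (\<forall>X\<in>D. irreducible_rep \<Gamma> \<rho> X)"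

text \<open>
  The multiplicity of the irreducible representation \<open>(\<sigma>, W)\<close> in \<open>(\<rho>, U)\<close> is the number of summands
  isomorphic to \<open>W\<close> in a decomposition of \<open>U\<close> into irreducibles. This number does not depend
  on the decomposition (Krull-Schmidt); the definite description expresses exactly that.
\<close>

definition multiplicity_in ::
  "('g, 'm) monoid_scheme \<Rightarrow> ('g \<Rightarrow> 'w \<Rightarrow> 'w) \<Rightarrow> 'w::real_vector set \<Rightarrow>
    ('g \<Rightarrow> 'v \<Rightarrow> 'v) \<Rightarrow> 'v::real_vector set \<Rightarrow> nat"
  where "multiplicity_in \<Gamma> \<sigma> W \<rho> U =
    (THE m. \<exists>D. irreducible_decomposition \<Gamma> \<rho> U D \<and> m = card {X \<in> D. rep_iso \<Gamma> \<rho> X \<sigma> W})"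

definition isotypic_component ::
  "('g, 'm) monoid_scheme \<Rightarrow> ('g \<Rightarrow> 'w \<Rightarrow> 'w) \<Rightarrow> 'w::real_vector set \<Rightarrow>
    ('g \<Rightarrow> 'v \<Rightarrow> 'v) \<Rightarrow> 'v::real_vector set \<Rightarrow> 'v set"
  where "isotypic_component \<Gamma> \<sigma> W \<rho> U =
    span (\<Union>{X. subrep \<Gamma> \<rho> U X \<and> rep_iso \<Gamma> \<rho> X \<sigma> W})"

text \<open>
  The (nonzero) isotypic components of \<open>U\<close>: every irreducible representation that occurs in \<open>U\<close>
  is isomorphic to a subrepresentation of \<open>U\<close>, so it suffices to let those index the components.
\<close>

definition isotypic_components ::
  "('g, 'm) monoid_scheme \<Rightarrow> ('g \<Rightarrow> 'v \<Rightarrow> 'v) \<Rightarrow> 'v::real_vector set \<Rightarrow> 'v set set"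
  where "isotypic_components \<Gamma> \<rho> U =
    {isotypic_component \<Gamma> \<rho> Y \<rho> U | Y. subrep \<Gamma> \<rho> U Y \<and> irreducible_rep \<Gamma> \<rho> Y}"

end

theory Submission
  imports Defs
begin

text \<open>
  The translation action on \<open>\<real>\<^sup>V\<close> is the real regular representation of \<open>\<Gamma>\<close>. A linear map commuting
  with it is determined by its value on the indicator of the identity; because \<open>\<Gamma>\<close> is abelian, this
  makes it a linear combination of translations (lemma \<open>commuting_with_translate\<close>). Hence it maps
  \<^emph>\<open>every\<close> subrepresentation into itself. This single property, abstracted in the locale
  \<open>multiplicity_free_rep\<close>, yields everything, without characters or complexification.

  An isomorphism between subrepresentations, precomposed with the orthogonal projection onto its
  domain, is a commuting linear map. So isomorphic subrepresentations are \<^emph>\<open>equal\<close>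
  (\<open>rep_iso_imp_eq\<close>). In the same way the projection onto an irreducible subrepresentation preserves
  every other one, so distinct irreducible subrepresentations are orthogonal
  (\<open>irreducibles_orthogonal\<close>). Together with complete reducibility, a subrepresentation \<open>U\<close> has
  exactly one decomposition into irreducibles, namely the set of all its irreducible
  subrepresentations; these are also its isotypic components, and each occurs once. The eigenspace
  \<open>\<E>\<^sub>\<lambda>\<close> is such a \<open>U\<close>, because the edge set is translation invariant.

  For the cone, the form \<open>\<phi> \<mapsto> \<Sum>\<^bsub>uv\<in>O\<^esub> (\<phi>(u) - \<phi>(v))\<^sup>2\<close> of an edge orbit \<open>O\<close> is invariant,
  hence belongs to a commuting symmetric map. On an irreducible subrepresentation \<open>X\<close> that map is a
  scalar \<open>\<mu>\<^sub>O(X)\<close>, since its largest eigenvalue has an invariant eigenspace. Therefore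
  \<open>\<ell>\<^sub>\<Gamma>(\<phi>) = \<Sum>\<^sub>X \<parallel>\<phi>\<^sub>X\<parallel>\<^sup>2 \<mu>(X)\<close>, where \<open>\<phi>\<^sub>X\<close> is the component of \<open>\<phi>\<close> in \<open>X\<close>. The
  numbers \<open>\<parallel>\<phi>\<^sub>X\<parallel>\<^sup>2\<close> are arbitrary nonnegative reals, so the image is the cone spanned by the
  vectors \<open>\<mu>(X)\<close> (\<open>polyhedral_cone_commuting_forms\<close>).
\<close>

section \<open>Orthogonal projection and finitely generated cones\<close>

definition oproj :: "'v::euclidean_space set \<Rightarrow> 'v \<Rightarrow> 'v"
  where "oproj X x = (THE p. p \<in> X \<and> (\<forall>y\<in>X. (x - p) \<bullet> y = 0))"

lemma oproj_ex1:
  fixes X :: "'v::euclidean_space set"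
  assumes "subspace X"
  shows "\<exists>!p. p \<in> X \<and> (\<forall>y\<in>X. (x - p) \<bullet> y = 0)"
proof -
  have sp: "span X = X" using assms by (simp add: span_eq_iff)
  obtain y z where yz: "y \<in> X" "\<And>w. w \<in> X \<Longrightarrow> orthogonal z w" "x = y + z"
    using orthogonal_subspace_decomp_exists[of X x] unfolding sp by blast
  show ?thesis
  proof (rule ex1I[of _ y])
    show "y \<in> X \<and> (\<forall>w\<in>X. (x - y) \<bullet> w = 0)" using yz by (auto simp: orthogonal_def)
  next
    fix p assume p: "p \<in> X \<and> (\<forall>w\<in>X. (x - p) \<bullet> w = 0)"
    have "p - y \<in> X" using p yz(1) assms by (simp add: subspace_diff)
    then have "(x - p) \<bullet> (p - y) = 0" "z \<bullet> (p - y) = 0"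
      using p yz(2) by (auto simp: orthogonal_def)
    then have "(p - y) \<bullet> (p - y) = 0" unfolding yz(3) by (simp add: algebra_simps)
    then show "p = y" by simp
  qed
qed

lemma oproj_in: "subspace X \<Longrightarrow> oproj X x \<in> X"
  and oproj_orth: "subspace X \<Longrightarrow> y \<in> X \<Longrightarrow> (x - oproj X x) \<bullet> y = 0"
  using theI'[OF oproj_ex1, of X x] unfolding oproj_def by blast+

lemma oproj_eqI:
  assumes "subspace X" "p \<in> X" "\<And>y. y \<in> X \<Longrightarrow> (x - p) \<bullet> y = 0"
  shows "oproj X x = p"
  unfolding oproj_def using assms oproj_ex1[OF assms(1), of x] by (intro the1_equality) auto

lemma oproj_id: "subspace X \<Longrightarrow> x \<in> X \<Longrightarrow> oproj X x = x"
  by (rule oproj_eqI) auto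

lemma linear_oproj:
  assumes X: "subspace X" shows "linear (oproj X)"
proof (rule linearI)
  fix x y
  show "oproj X (x + y) = oproj X x + oproj X y"
  proof (rule oproj_eqI[OF X])
    show "oproj X x + oproj X y \<in> X" by (simp add: X oproj_in subspace_add)
    fix w assume "w \<in> X"
    then show "(x + y - (oproj X x + oproj X y)) \<bullet> w = 0"
      using oproj_orth[OF X, of w x] oproj_orth[OF X, of w y] by (simp add: algebra_simps)
  qed
next
  fix c x
  show "oproj X (c *\<^sub>R x) = c *\<^sub>R oproj X x"
  proof (rule oproj_eqI[OF X])
    show "c *\<^sub>R oproj X x \<in> X" by (simp add: X oproj_in subspace_scale)
    fix w assume "w \<in> X"
    then show "(c *\<^sub>R x - c *\<^sub>R oproj X x) \<bullet> w = 0"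
      using oproj_orth[OF X, of w x] by (simp flip: scaleR_diff_right)
  qed
qed

text \<open>
  The definition of a polyhedral cone sums over a \<^emph>\<open>set\<close> of generators, whereas the generators
  below are indexed by subrepresentations and may coincide.
\<close>

lemma polyhedral_cone_indexed:
  fixes v :: "'i \<Rightarrow> 'v::real_vector"
  assumes fin: "finite I"
  shows "polyhedral_cone {\<Sum>i\<in>I. c i *\<^sub>R v i | c. \<forall>i\<in>I. 0 \<le> c i}"
  unfolding polyhedral_cone_def
proof (intro exI conjI)
  show "finite (v ` I)" using fin by simp
  show "{\<Sum>i\<in>I. c i *\<^sub>R v i | c. \<forall>i\<in>I. 0 \<le> c i}
      = {\<Sum>w\<in>v ` I. c w *\<^sub>R w | c. \<forall>w\<in>v ` I. 0 \<le> c w}" (is "?L = ?R")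
  proof
    show "?L \<subseteq> ?R"
    proof
      fix x assume "x \<in> ?L"
      then obtain c where c: "\<forall>i\<in>I. 0 \<le> c i" and x: "x = (\<Sum>i\<in>I. c i *\<^sub>R v i)" by blast
      define d where "d w = (\<Sum>i\<in>{i\<in>I. v i = w}. c i)" for w
      have "x = (\<Sum>w\<in>v ` I. \<Sum>i\<in>{i\<in>I. v i = w}. c i *\<^sub>R v i)"
        unfolding x by (rule sum.image_gen[OF fin])
      also have "\<dots> = (\<Sum>w\<in>v ` I. d w *\<^sub>R w)"
        by (rule sum.cong[OF refl]) (simp add: d_def scaleR_sum_left)
      finally show "x \<in> ?R" using c by (auto simp: d_def intro!: exI[of _ d] sum_nonneg)
    qed
  next
    show "?R \<subseteq> ?L"
    proof
      fix x assume "x \<in> ?R"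
      then obtain d where d: "\<forall>w\<in>v ` I. 0 \<le> d w" and x: "x = (\<Sum>w\<in>v ` I. d w *\<^sub>R w)" by blast
      \<comment> \<open>All of the coefficient of a generator goes to one chosen index of it.\<close>
      define r where "r = inv_into I v"
      define c where "c i = (if r (v i) = i then d (v i) else 0)" for i
      have r: "r w \<in> I" "v (r w) = w" if "w \<in> v ` I" for w
        using that by (auto simp: r_def inv_into_into f_inv_into_f)
      have "(\<Sum>i\<in>I. c i *\<^sub>R v i) = (\<Sum>i\<in>r ` v ` I. c i *\<^sub>R v i)"
      proof (rule sum.mono_neutral_right[OF fin])
        show "r ` v ` I \<subseteq> I" using r by auto
        have "r (v i) \<noteq> i" if "i \<in> I - r ` v ` I" for i using that by (metis DiffE imageI)
        then show "\<forall>i\<in>I - r ` v ` I. c i *\<^sub>R v i = 0" by (simp add: c_def)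
      qed
      also have "\<dots> = (\<Sum>w\<in>v ` I. c (r w) *\<^sub>R v (r w))"
        using r(2) by (intro sum.reindex_cong[OF inj_on_inverseI[of _ v] refl refl])
      also have "\<dots> = x" unfolding x by (rule sum.cong[OF refl]) (simp add: c_def r)
      finally show "x \<in> ?L" using d by (auto simp: c_def intro!: exI[of _ c])
    qed
  qed
qed

section \<open>Orthogonal representations\<close>

locale orthogonal_rep = group \<Gamma> for \<Gamma> :: "('g, 'm) monoid_scheme" (structure) +
  fixes \<rho> :: "'g \<Rightarrow> 'v::euclidean_space \<Rightarrow> 'v"
  assumes linear_rho: "g \<in> carrier \<Gamma> \<Longrightarrow> linear (\<rho> g)"
    and rho_one: "\<rho> \<one> x = x"
    and rho_mult: "g \<in> carrier \<Gamma> \<Longrightarrow> h \<in> carrier \<Gamma> \<Longrightarrow> \<rho> (g \<otimes> h) x = \<rho> g (\<rho> h x)"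
    and rho_inner: "g \<in> carrier \<Gamma> \<Longrightarrow> \<rho> g x \<bullet> \<rho> g y = x \<bullet> y"
begin

definition commuting :: "('v \<Rightarrow> 'v) \<Rightarrow> bool"
  where "commuting A \<longleftrightarrow> linear A \<and> (\<forall>g\<in>carrier \<Gamma>. \<forall>x. A (\<rho> g x) = \<rho> g (A x))"

lemma subrep_iff: "subrep \<Gamma> \<rho> U X \<longleftrightarrow> subrep \<Gamma> \<rho> UNIV X \<and> X \<subseteq> U"
  by (auto simp: subrep_def)

lemma subrep_rho: "subrep \<Gamma> \<rho> U X \<Longrightarrow> g \<in> carrier \<Gamma> \<Longrightarrow> x \<in> X \<Longrightarrow> \<rho> g x \<in> X"
  by (auto simp: subrep_def)

lemma subrep_subspace: "subrep \<Gamma> \<rho> U X \<Longrightarrow> subspace X"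
  by (simp add: subrep_def)

lemma rho_inv:
  assumes "g \<in> carrier \<Gamma>"
  shows "\<rho> g (\<rho> (inv g) x) = x" "\<rho> (inv g) (\<rho> g x) = x"
  using assms rho_mult[of g "inv g" x] rho_mult[of "inv g" g x] by (simp_all add: rho_one)

lemma rho_inner_left: "g \<in> carrier \<Gamma> \<Longrightarrow> \<rho> g x \<bullet> y = x \<bullet> \<rho> (inv g) y"
  by (metis inv_closed rho_inner rho_inv(2))

lemma real_rep_subrep: "real_rep \<Gamma> \<rho> X \<longleftrightarrow> subrep \<Gamma> \<rho> UNIV X"
  using linear_rho
  by (auto simp: real_rep_def subrep_def linear_on_def rho_one rho_mult linear_add linear_scale)

lemma irreducible_subrep: "irreducible_rep \<Gamma> \<rho> X \<Longrightarrow> subrep \<Gamma> \<rho> UNIV X"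
  by (simp add: irreducible_rep_def real_rep_subrep)

lemma irreducible_cases:
  assumes "irreducible_rep \<Gamma> \<rho> X" "subrep \<Gamma> \<rho> UNIV Z" "Z \<subseteq> X"
  shows "Z = {0} \<or> Z = X"
  using assms subrep_iff[of X Z] by (auto simp: irreducible_rep_def)

lemma subrep_Int: "subrep \<Gamma> \<rho> U X \<Longrightarrow> subrep \<Gamma> \<rho> U Y \<Longrightarrow> subrep \<Gamma> \<rho> U (X \<inter> Y)"
  by (auto simp: subrep_def subspace_inter image_subset_iff)

lemma commuting_oproj:
  assumes X: "subrep \<Gamma> \<rho> UNIV X"
  shows "commuting (oproj X)"
  unfolding commuting_def
proof (intro conjI ballI allI)
  have sX: "subspace X" using X by (rule subrep_subspace)
  then show "linear (oproj X)" by (rule linear_oproj)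
  fix g x assume g: "g \<in> carrier \<Gamma>"
  show "oproj X (\<rho> g x) = \<rho> g (oproj X x)"
  proof (rule oproj_eqI[OF sX])
    show "\<rho> g (oproj X x) \<in> X" using X g oproj_in[OF sX] by (rule subrep_rho)
    fix y assume "y \<in> X"
    then have "\<rho> (inv g) y \<in> X" using X g by (auto intro: subrep_rho)
    then have "(x - oproj X x) \<bullet> \<rho> (inv g) y = 0" by (rule oproj_orth[OF sX])
    then show "(\<rho> g x - \<rho> g (oproj X x)) \<bullet> y = 0"
      using g by (simp add: rho_inner_left flip: linear_diff[OF linear_rho])
  qed
qed

lemma subrep_orthogonal_complement:
  assumes U: "subrep \<Gamma> \<rho> UNIV U" and N: "\<And>g x. g \<in> carrier \<Gamma> \<Longrightarrow> x \<in> N \<Longrightarrow> \<rho> g x \<in> N"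
  shows "subrep \<Gamma> \<rho> U {x\<in>U. \<forall>y\<in>N. x \<bullet> y = 0}"
proof -
  have "subspace {x\<in>U. \<forall>y\<in>N. x \<bullet> y = 0}"
    using subrep_subspace[OF U] by (auto simp: subspace_def inner_add_left)
  moreover have "\<rho> g x \<in> U" if "g \<in> carrier \<Gamma>" "x \<in> U" for g x
    using U that by (rule subrep_rho)
  moreover have "\<rho> g x \<bullet> y = 0"
    if "g \<in> carrier \<Gamma>" "\<forall>y\<in>N. x \<bullet> y = 0" "y \<in> N" for g x y
    using that N[of "inv g"] by (simp add: rho_inner_left)
  ultimately show ?thesis by (auto simp: subrep_def image_subset_iff)
qed

lemma subrep_eigenspace:
  assumes X: "subrep \<Gamma> \<rho> UNIV X" and A: "commuting A"
  shows "subrep \<Gamma> \<rho> X {x\<in>X. A x = c *\<^sub>R x}"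
proof -
  have lin: "linear A" and com: "\<And>g x. g \<in> carrier \<Gamma> \<Longrightarrow> A (\<rho> g x) = \<rho> g (A x)"
    using A by (auto simp: commuting_def)
  have "subspace {x\<in>X. A x = c *\<^sub>R x}"
    using subrep_subspace[OF X] lin
    by (auto simp: subspace_def linear_0 linear_add linear_scale scaleR_add_right)
  then show ?thesis
    using X by (auto simp: subrep_def com linear_scale[OF linear_rho])
qed

lemma ex_irreducible_subrep:
  assumes "subrep \<Gamma> \<rho> UNIV M" "M \<noteq> {0}"
  shows "\<exists>Y. Y \<subseteq> M \<and> irreducible_rep \<Gamma> \<rho> Y"
  using assms
proof (induction "dim M" arbitrary: M rule: less_induct)
  case less
  show ?case
  proof (cases "irreducible_rep \<Gamma> \<rho> M")
    case False
    then obtain Z where Z: "subrep \<Gamma> \<rho> M Z" "Z \<noteq> {0}" "Z \<noteq> M"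
      using less.prems by (auto simp: irreducible_rep_def real_rep_subrep)
    then have Z': "subrep \<Gamma> \<rho> UNIV Z" "Z \<subset> M" using subrep_iff[of M Z] by auto
    have "dim Z < dim M"
      using Z' less.prems by (intro dim_psubset) (simp add: span_eq_iff[THEN iffD2] subrep_subspace)
    then show ?thesis using less.hyps[OF _ Z'(1) Z(2)] Z'(2) by blast
  qed auto
qed

definition irreducibles :: "'v set \<Rightarrow> 'v set set"
  where "irreducibles U = {X. X \<subseteq> U \<and> irreducible_rep \<Gamma> \<rho> X}"

lemma irreducibles_subspace: "X \<in> irreducibles U \<Longrightarrow> subspace X"
  by (auto simp: irreducibles_def dest: irreducible_subrep subrep_subspace)

lemma orthogonal_to_irreducibles_eq_0:
  assumes U: "subrep \<Gamma> \<rho> UNIV U" and x: "x \<in> U"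
    and orth: "\<And>X y. X \<in> irreducibles U \<Longrightarrow> y \<in> X \<Longrightarrow> x \<bullet> y = 0"
  shows "x = 0"
proof (rule ccontr)
  assume "x \<noteq> 0"
  define N where "N = \<Union>(irreducibles U)"
  define M where "M = {x\<in>U. \<forall>y\<in>N. x \<bullet> y = 0}"
  have "\<rho> g y \<in> N" if "g \<in> carrier \<Gamma>" "y \<in> N" for g y
    using that by (auto simp: N_def irreducibles_def dest: irreducible_subrep subrep_rho)
  then have M: "subrep \<Gamma> \<rho> U M" unfolding M_def by (rule subrep_orthogonal_complement[OF U])
  have "x \<in> M" using x orth by (auto simp: M_def N_def)
  with \<open>x \<noteq> 0\<close> have "M \<noteq> {0}" by auto
  moreover have "subrep \<Gamma> \<rho> UNIV M" using M subrep_iff by blast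
  ultimately obtain Y where Y: "Y \<subseteq> M" "irreducible_rep \<Gamma> \<rho> Y"
    using ex_irreducible_subrep by blast
  then have "Y \<subseteq> N" using M by (auto simp: N_def irreducibles_def subrep_def)
  \<comment> \<open>So \<open>Y\<close> is orthogonal to itself.\<close>
  then have "y = 0" if "y \<in> Y" for y using that Y(1) by (force simp: M_def)
  moreover have "0 \<in> Y" using Y(2) irreducible_subrep subrep_subspace subspace_0 by blast
  ultimately show False using Y(2) by (auto simp: irreducible_rep_def)
qed

text \<open>
  A maximiser of the Rayleigh quotient on \<open>X\<close> is an eigenvector, so the corresponding eigenspace is
  a nonzero subrepresentation and must be all of \<open>X\<close>.
\<close>

lemma symmetric_commuting_scalar:
  assumes X: "irreducible_rep \<Gamma> \<rho> X" and A: "commuting A"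
    and sym: "\<And>x y. x \<bullet> A y = A x \<bullet> y" and AX: "\<And>x. x \<in> X \<Longrightarrow> A x \<in> X"
  shows "\<exists>\<mu>. \<forall>x\<in>X. A x = \<mu> *\<^sub>R x"
proof -
  have srX: "subrep \<Gamma> \<rho> UNIV X" using X by (rule irreducible_subrep)
  then have sX: "subspace X" by (rule subrep_subspace)
  have lin: "linear A" using A by (simp add: commuting_def)
  define S where "S = X \<inter> sphere 0 1"
  have comp: "compact S" unfolding S_def
    by (rule closed_Int_compact[OF closed_subspace[OF sX]]) simp
  have "\<exists>x\<in>X. x \<noteq> 0" using X sX by (auto simp: irreducible_rep_def dest: subspace_0)
  then obtain x1 where x1: "x1 \<in> X" "x1 \<noteq> 0" by blast
  then have "x1 /\<^sub>R norm x1 \<in> S" by (auto simp: S_def sX subspace_scale)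
  then have ne: "S \<noteq> {}" by blast
  have cont: "continuous_on S (\<lambda>x. x \<bullet> A x)"
    using lin by (intro continuous_intros linear_continuous_on linear_conv_bounded_linear[THEN iffD1])
  obtain x0 where x0: "x0 \<in> S" "\<And>y. y \<in> S \<Longrightarrow> y \<bullet> A y \<le> x0 \<bullet> A x0"
    using continuous_attains_sup[OF comp ne cont] by blast
  define \<mu> where "\<mu> = x0 \<bullet> A x0"
  define B where "B x = \<mu> *\<^sub>R x - A x" for x
  have linB: "linear B" unfolding B_def
    using lin by (intro linear_compose_sub) (auto intro: linear_scale_self linear_compose_scale_right linear_id[unfolded id_def])
  have symB: "x \<bullet> B y = B x \<bullet> y" for x y
    by (simp add: B_def inner_diff_left inner_diff_right sym)
  have posB: "0 \<le> y \<bullet> B y" if "y \<in> X" for y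
  proof (cases "y = 0")
    case False
    then have "y /\<^sub>R norm y \<in> S" using that by (auto simp: S_def sX subspace_scale)
    from x0(2)[OF this] have "(y \<bullet> A y) / (norm y)\<^sup>2 \<le> \<mu>"
      using lin by (simp add: \<mu>_def linear_scale power2_eq_square divide_inverse mult_ac)
    then have "y \<bullet> A y \<le> \<mu> * (norm y)\<^sup>2" using False by (simp add: divide_le_eq)
    then show ?thesis by (simp add: B_def inner_diff_right power2_norm_eq_inner)
  qed simp
  have x0X: "x0 \<in> X" and n0: "norm x0 = 1" using x0(1) by (auto simp: S_def)
  have zero: "x0 \<bullet> B x0 = 0"
    using n0 by (simp add: B_def inner_diff_right \<mu>_def norm_eq_1)
  define y where "y = B x0"
  have yX: "y \<in> X" by (simp add: y_def B_def sX AX x0X subspace_diff subspace_scale)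
  \<comment> \<open>A nonnegative form vanishing at \<open>x0\<close> has \<open>x0\<close> in its kernel: the form is a nonnegative
    polynomial in \<open>t\<close> along \<open>x0 + t y\<close>, without constant term.\<close>
  have poly: "0 \<le> 2 * t * (y \<bullet> y) + t\<^sup>2 * (y \<bullet> B y)" for t
  proof -
    have "x0 + t *\<^sub>R y \<in> X" by (simp add: sX subspace_add subspace_scale x0X yX)
    from posB[OF this] show ?thesis
      using zero symB[of x0 y] linB
      by (simp add: linear_add linear_scale inner_add_left inner_add_right y_def power2_eq_square
          mult_ac)
  qed
  have "y \<bullet> y = 0"
  proof (rule ccontr)
    assume nz: "y \<bullet> y \<noteq> 0"
    then have p: "y \<bullet> y > 0" using inner_ge_zero[of y] by linarith
    define b where "b = y \<bullet> B y"
    have b: "0 \<le> b" using posB[OF yX] by (simp add: b_def)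
    \<comment> \<open>The minimiser is at \<open>- (y \<bullet> y) / b\<close>; adding 1 covers \<open>b = 0\<close>.\<close>
    define t where "t = - (y \<bullet> y) / (b + 1)"
    have tneg: "t < 0" using p b by (simp add: t_def divide_neg_pos)
    have "t * (2 * (y \<bullet> y) + t * b) \<ge> 0"
      using poly[of t] by (simp add: b_def power2_eq_square algebra_simps)
    then have "2 * (y \<bullet> y) + t * b \<le> 0"
      using tneg by (simp add: zero_le_mult_iff)
    moreover have "t * b \<ge> - (y \<bullet> y)"
      using p b by (simp add: t_def field_simps)
    ultimately show False using p by linarith
  qed
  then have eig: "A x0 = \<mu> *\<^sub>R x0" by (simp add: y_def B_def)
  define Z where "Z = {x\<in>X. A x = \<mu> *\<^sub>R x}"
  have "x0 \<in> Z" "x0 \<noteq> 0" using eig x0X n0 by (auto simp: Z_def)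
  moreover have "subrep \<Gamma> \<rho> X Z" unfolding Z_def by (rule subrep_eigenspace[OF srX A])
  then have "Z = {0} \<or> Z = X" using X by (simp add: irreducible_rep_def)
  ultimately have "Z = X" by auto
  then show ?thesis by (auto simp: Z_def)
qed

end

section \<open>Multiplicity-free representations\<close>

text \<open>
  The hypothesis is equivalent to being a sum of pairwise non-isomorphic irreducibles: two
  isomorphic summands would be interchanged by some commuting map. It is the form in which
  multiplicity-freeness is visible for a commutative group acting on itself.
\<close>

locale multiplicity_free_rep = orthogonal_rep \<Gamma> \<rho>
  for \<Gamma> :: "('g, 'm) monoid_scheme" (structure)
    and \<rho> :: "'g \<Rightarrow> 'v::euclidean_space \<Rightarrow> 'v" +
  assumes commuting_preserves:
    "commuting A \<Longrightarrow> subrep \<Gamma> \<rho> UNIV X \<Longrightarrow> x \<in> X \<Longrightarrow> A x \<in> X"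
begin

lemma rep_iso_imp_subset:
  fixes \<sigma> :: "'g \<Rightarrow> 'w::real_vector \<Rightarrow> 'w"
  assumes X: "subrep \<Gamma> \<rho> UNIV X" and Y: "subrep \<Gamma> \<rho> UNIV Y"
    and XW: "rep_iso \<Gamma> \<rho> X \<sigma> W" and YW: "rep_iso \<Gamma> \<rho> Y \<sigma> W"
  shows "Y \<subseteq> X"
proof -
  have sX: "subspace X" and sY: "subspace Y" using X Y by (auto intro: subrep_subspace)
  obtain f where f: "linear_on X f" "bij_betw f X W"
    "\<And>g x. g \<in> carrier \<Gamma> \<Longrightarrow> x \<in> X \<Longrightarrow> f (\<rho> g x) = \<sigma> g (f x)"
    using XW unfolding rep_iso_def by blast
  obtain k where k: "linear_on Y k" "bij_betw k Y W"
    "\<And>g x. g \<in> carrier \<Gamma> \<Longrightarrow> x \<in> Y \<Longrightarrow> k (\<rho> g x) = \<sigma> g (k x)"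
    using YW unfolding rep_iso_def by blast
  define q where "q = inv_into Y k"
  have qin: "q w \<in> Y" "k (q w) = w" if "w \<in> W" for w
    using that k(2) by (auto simp: q_def bij_betw_def inv_into_into f_inv_into_f)
  have qk: "q (k y) = y" if "y \<in> Y" for y
    using that k(2) by (simp add: q_def bij_betw_def)
  have fW: "f x \<in> W" if "x \<in> X" for x using that f(2) by (auto simp: bij_betw_def)
  have q_eq: "q (f x) = y" if "y \<in> Y" "k y = f x" for x y using that qk by metis
  define F where "F x = q (f (oproj X x))" for x
  have "commuting F" unfolding commuting_def
  proof (intro conjI ballI allI linearI)
    fix x y
    let ?a = "oproj X x" and ?b = "oproj X y"
    have ab: "?a \<in> X" "?b \<in> X" by (simp_all add: oproj_in sX)
    have "q (f (?a + ?b)) = q (f ?a) + q (f ?b)"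
      using ab qin fW f(1) k(1) sY by (intro q_eq) (auto simp: linear_on_def subspace_add)
    then show "F (x + y) = F x + F y"
      by (simp add: F_def linear_add[OF linear_oproj[OF sX]])
  next
    fix c x
    let ?a = "oproj X x"
    have a: "?a \<in> X" by (simp add: oproj_in sX)
    have "q (f (c *\<^sub>R ?a)) = c *\<^sub>R q (f ?a)"
      using a qin fW f(1) k(1) sY by (intro q_eq) (auto simp: linear_on_def subspace_scale)
    then show "F (c *\<^sub>R x) = c *\<^sub>R F x"
      by (simp add: F_def linear_scale[OF linear_oproj[OF sX]])
  next
    fix g x assume g: "g \<in> carrier \<Gamma>"
    let ?a = "oproj X x"
    have a: "?a \<in> X" by (simp add: oproj_in sX)
    have "q (f (\<rho> g ?a)) = \<rho> g (q (f ?a))"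
      using a g qin fW f(3) k(3) by (intro q_eq) (auto intro: subrep_rho[OF Y])
    then show "F (\<rho> g x) = \<rho> g (F x)"
      using commuting_oproj[OF X] g by (simp add: F_def commuting_def)
  qed
  then have FX: "F x \<in> X" if "x \<in> X" for x using that X by (blast intro: commuting_preserves)
  show "Y \<subseteq> X"
  proof
    fix y assume y: "y \<in> Y"
    then have "k y \<in> f ` X" using k(2) f(2) by (auto simp: bij_betw_def)
    then obtain x where x: "x \<in> X" "k y = f x" by blast
    then have "F x = y" using q_eq[OF y] by (simp add: F_def oproj_id sX)
    then show "y \<in> X" using FX[OF x(1)] by simp
  qed
qed

lemma rep_iso_imp_eq:
  fixes \<sigma> :: "'g \<Rightarrow> 'w::real_vector \<Rightarrow> 'w"
  assumes "subrep \<Gamma> \<rho> UNIV X" "subrep \<Gamma> \<rho> UNIV Y"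
    and "rep_iso \<Gamma> \<rho> X \<sigma> W" "rep_iso \<Gamma> \<rho> Y \<sigma> W"
  shows "X = Y"
  using assms rep_iso_imp_subset by blast

lemma rep_iso_refl: "rep_iso \<Gamma> \<rho> X \<rho> X"
  unfolding rep_iso_def by (rule exI[of _ id]) (auto simp: linear_on_def)

text \<open>
  The projection onto \<open>Y\<close> maps \<open>X\<close> into \<open>X \<inter> Y\<close>, which is zero unless \<open>X = Y\<close>.
\<close>

lemma irreducibles_orthogonal:
  assumes X: "irreducible_rep \<Gamma> \<rho> X" and Y: "irreducible_rep \<Gamma> \<rho> Y" and "X \<noteq> Y"
    and x: "x \<in> X" and y: "y \<in> Y"
  shows "x \<bullet> y = 0"
proof -
  have sX: "subrep \<Gamma> \<rho> UNIV X" and sY: "subrep \<Gamma> \<rho> UNIV Y"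
    using X Y by (auto intro: irreducible_subrep)
  then have XY: "subrep \<Gamma> \<rho> UNIV (X \<inter> Y)" by (rule subrep_Int)
  have "X \<inter> Y = {0}"
    using irreducible_cases[OF X XY] irreducible_cases[OF Y XY] \<open>X \<noteq> Y\<close> by auto
  moreover have "oproj Y x \<in> X"
    using commuting_preserves[OF commuting_oproj[OF sY] sX x] .
  moreover have "oproj Y x \<in> Y" by (rule oproj_in[OF subrep_subspace[OF sY]])
  ultimately have "oproj Y x = 0" by auto
  then show ?thesis using oproj_orth[OF subrep_subspace[OF sY] y, of x] by simp
qed

lemma finite_irreducibles: "finite (irreducibles U)"
proof -
  have "\<exists>x\<in>X. x \<noteq> 0" if "X \<in> irreducibles U" for X
    using that irreducibles_subspace[OF that]
    by (auto simp: irreducibles_def irreducible_rep_def dest: subspace_0)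
  then obtain u where u: "\<And>X. X \<in> irreducibles U \<Longrightarrow> u X \<in> X \<and> u X \<noteq> 0" by metis
  have orth: "u X \<bullet> u Y = 0" if "X \<in> irreducibles U" "Y \<in> irreducibles U" "X \<noteq> Y" for X Y
    using that u by (intro irreducibles_orthogonal[of X Y]) (auto simp: irreducibles_def)
  then have "pairwise orthogonal (u ` irreducibles U)"
    by (auto simp: pairwise_def orthogonal_def)
  moreover have "0 \<notin> u ` irreducibles U" using u by fastforce
  ultimately have "finite (u ` irreducibles U)"
    using pairwise_orthogonal_independent finiteI_independent by blast
  moreover have "inj_on u (irreducibles U)"
    by (rule inj_onI) (metis orth u inner_eq_zero_iff)
  ultimately show ?thesis using finite_imageD by blast
qed

lemma sum_in_subspace_inner:
  assumes f: "\<And>X. X \<in> irreducibles U \<Longrightarrow> f X \<in> X" and X: "X \<in> irreducibles U" and y: "y \<in> X"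
  shows "(\<Sum>Z\<in>irreducibles U. f Z) \<bullet> y = f X \<bullet> y"
proof -
  have "(\<Sum>Z\<in>irreducibles U. f Z) \<bullet> y = (\<Sum>Z\<in>irreducibles U. if Z = X then f X \<bullet> y else 0)"
    unfolding inner_sum_left
  proof (rule sum.cong[OF refl])
    fix Z assume Z: "Z \<in> irreducibles U"
    show "f Z \<bullet> y = (if Z = X then f X \<bullet> y else 0)"
      using irreducibles_orthogonal[of Z X "f Z" y] Z f[OF Z] X y by (auto simp: irreducibles_def)
  qed
  then show ?thesis using X finite_irreducibles by simp
qed

lemma sum_oproj_irreducibles:
  assumes U: "subrep \<Gamma> \<rho> UNIV U" and u: "u \<in> U"
  shows "(\<Sum>X\<in>irreducibles U. oproj X u) = u"
proof -
  let ?p = "\<Sum>X\<in>irreducibles U. oproj X u"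
  have op: "oproj X u \<in> X" if "X \<in> irreducibles U" for X
    using that irreducibles_subspace oproj_in by blast
  have "?p \<in> U"
    using op subrep_subspace[OF U] by (intro subspace_sum) (auto simp: irreducibles_def)
  then have "u - ?p \<in> U" using u subrep_subspace[OF U] by (simp add: subspace_diff)
  moreover have "(u - ?p) \<bullet> y = 0" if "X \<in> irreducibles U" "y \<in> X" for X y
    using sum_in_subspace_inner[OF op that] oproj_orth[OF irreducibles_subspace[OF that(1)] that(2), of u]
    by (simp add: inner_diff_left)
  ultimately have "u - ?p = 0" by (rule orthogonal_to_irreducibles_eq_0[OF U])
  then show ?thesis by simp
qed

lemma is_direct_sum_irreducibles:
  assumes U: "subrep \<Gamma> \<rho> UNIV U"
  shows "is_direct_sum U (irreducibles U)"
  unfolding is_direct_sum_def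
proof (intro conjI ballI bij_betw_imageI)
  let ?D = "irreducibles U"
  show "finite ?D" by (rule finite_irreducibles)
  show "subspace X" if "X \<in> ?D" for X using that by (rule irreducibles_subspace)
  show "inj_on (\<lambda>f. \<Sum>X\<in>?D. f X) (\<Pi>\<^sub>E X\<in>?D. X)"
  proof (rule inj_onI)
    fix f h assume f: "f \<in> (\<Pi>\<^sub>E X\<in>?D. X)" and h: "h \<in> (\<Pi>\<^sub>E X\<in>?D. X)"
      and eq: "(\<Sum>X\<in>?D. f X) = (\<Sum>X\<in>?D. h X)"
    show "f = h"
    proof (rule PiE_ext[OF f h])
      fix X assume X: "X \<in> ?D"
      have fh: "f X \<in> X" "h X \<in> X" if "X \<in> ?D" for X using f h that by (auto dest: PiE_mem)
      then have d: "f X - h X \<in> X" using X irreducibles_subspace subspace_diff by blast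
      have "f X \<bullet> (f X - h X) = h X \<bullet> (f X - h X)"
        using sum_in_subspace_inner[of U f, OF fh(1) X d] sum_in_subspace_inner[of U h, OF fh(2) X d] eq
        by simp
      then have "(f X - h X) \<bullet> (f X - h X) = 0" by (simp add: inner_diff_left)
      then show "f X = h X" by simp
    qed
  qed
  show "(\<lambda>f. \<Sum>X\<in>?D. f X) ` (\<Pi>\<^sub>E X\<in>?D. X) = U"
  proof (intro equalityI subsetI)
    fix u assume "u \<in> (\<lambda>f. \<Sum>X\<in>?D. f X) ` (\<Pi>\<^sub>E X\<in>?D. X)"
    then show "u \<in> U" using subrep_subspace[OF U]
      by (auto simp: irreducibles_def intro!: subspace_sum dest: PiE_mem)
  next
    fix u assume "u \<in> U"
    then have "u = (\<Sum>X\<in>?D. restrict (\<lambda>X. oproj X u) ?D X)"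
      using sum_oproj_irreducibles[OF U] by simp
    moreover have "restrict (\<lambda>X. oproj X u) ?D \<in> (\<Pi>\<^sub>E X\<in>?D. X)"
      using irreducibles_subspace oproj_in by auto
    ultimately show "u \<in> (\<lambda>f. \<Sum>X\<in>?D. f X) ` (\<Pi>\<^sub>E X\<in>?D. X)" by blast
  qed
qed

text \<open>
  An irreducible missing from a decomposition would be orthogonal to all summands, hence to \<open>U\<close>.
\<close>

lemma irreducible_decomposition_iff:
  assumes U: "subrep \<Gamma> \<rho> UNIV U"
  shows "irreducible_decomposition \<Gamma> \<rho> U D \<longleftrightarrow> D = irreducibles U"
proof
  assume "D = irreducibles U"
  then show "irreducible_decomposition \<Gamma> \<rho> U D"
    using is_direct_sum_irreducibles[OF U]
    by (auto simp: irreducible_decomposition_def irreducibles_def)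
next
  assume "irreducible_decomposition \<Gamma> \<rho> U D"
  then have ds: "is_direct_sum U D" and irr: "\<And>X. X \<in> D \<Longrightarrow> irreducible_rep \<Gamma> \<rho> X"
    by (auto simp: irreducible_decomposition_def)
  from ds have fin: "finite D" and sub: "\<And>X. X \<in> D \<Longrightarrow> subspace X"
    and img: "(\<lambda>f. \<Sum>X\<in>D. f X) ` (\<Pi>\<^sub>E X\<in>D. X) = U"
    by (auto simp: is_direct_sum_def bij_betw_def)
  show "D = irreducibles U"
  proof
    show "D \<subseteq> irreducibles U"
    proof
      fix X assume X: "X \<in> D"
      have "x \<in> U" if x: "x \<in> X" for x
      proof -
        define f where "f = (\<lambda>Z\<in>D. if Z = X then x else 0)"
        have "f \<in> (\<Pi>\<^sub>E X\<in>D. X)" using x sub by (auto simp: f_def subspace_0)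
        then have "(\<Sum>X\<in>D. f X) \<in> U" using img by blast
        moreover have "(\<Sum>X\<in>D. f X) = x" using fin X by (simp add: f_def)
        ultimately show ?thesis by simp
      qed
      then show "X \<in> irreducibles U" using irr[OF X] by (auto simp: irreducibles_def)
    qed
  next
    show "irreducibles U \<subseteq> D"
    proof (rule subsetI, rule ccontr)
      fix Y assume Y: "Y \<in> irreducibles U" and nD: "Y \<notin> D"
      have "y = 0" if y: "y \<in> Y" for y
      proof -
        have "y \<in> U" using y Y by (auto simp: irreducibles_def)
        then obtain f where f: "f \<in> (\<Pi>\<^sub>E X\<in>D. X)" "y = (\<Sum>X\<in>D. f X)" using img by blast
        have "f X \<bullet> y = 0" if "X \<in> D" for X
          using that irr f(1) Y y nD
          by (intro irreducibles_orthogonal[of X Y]) (auto simp: irreducibles_def dest: PiE_mem)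
        then have "(\<Sum>X\<in>D. f X) \<bullet> y = 0" by (simp add: inner_sum_left)
        then show "y = 0" using f(2) by simp
      qed
      then show False
        using Y irreducibles_subspace[OF Y]
        by (auto simp: irreducibles_def irreducible_rep_def dest: subspace_0)
    qed
  qed
qed

lemma multiplicity_in_eq_card:
  fixes \<sigma> :: "'g \<Rightarrow> 'w::real_vector \<Rightarrow> 'w"
  assumes U: "subrep \<Gamma> \<rho> UNIV U"
  shows "multiplicity_in \<Gamma> \<sigma> W \<rho> U = card {X \<in> irreducibles U. rep_iso \<Gamma> \<rho> X \<sigma> W}"
  unfolding multiplicity_in_def irreducible_decomposition_iff[OF U] by simp

lemma multiplicity_in_le_1:
  fixes \<sigma> :: "'g \<Rightarrow> 'w::real_vector \<Rightarrow> 'w"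
  assumes U: "subrep \<Gamma> \<rho> UNIV U"
  shows "multiplicity_in \<Gamma> \<sigma> W \<rho> U \<le> 1"
proof -
  have "X = Y" if "X \<in> irreducibles U" "Y \<in> irreducibles U"
    "rep_iso \<Gamma> \<rho> X \<sigma> W" "rep_iso \<Gamma> \<rho> Y \<sigma> W" for X Y
    using that rep_iso_imp_eq irreducible_subrep unfolding irreducibles_def by blast
  then show ?thesis
    unfolding multiplicity_in_eq_card[OF U] using finite_irreducibles[of U]
    by (auto simp: card_le_Suc0_iff_eq)
qed

lemma isotypic_component_eq:
  assumes "subrep \<Gamma> \<rho> U Y"
  shows "isotypic_component \<Gamma> \<rho> Y \<rho> U = Y"
proof -
  have "{X. subrep \<Gamma> \<rho> U X \<and> rep_iso \<Gamma> \<rho> X \<rho> Y} = {Y}"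
    using assms rep_iso_refl rep_iso_imp_eq subrep_iff by blast
  then show ?thesis
    using assms by (simp add: isotypic_component_def span_eq_iff[THEN iffD2] subrep_def)
qed

lemma isotypic_components_eq: "isotypic_components \<Gamma> \<rho> U = irreducibles U"
proof -
  have "subrep \<Gamma> \<rho> U Y \<and> irreducible_rep \<Gamma> \<rho> Y \<longleftrightarrow> Y \<in> irreducibles U" for Y
    using subrep_iff[of U Y] irreducible_subrep by (auto simp: irreducibles_def)
  moreover have "isotypic_component \<Gamma> \<rho> Y \<rho> U = Y" if "Y \<in> irreducibles U" for Y
    using that calculation isotypic_component_eq by blast
  ultimately show ?thesis unfolding isotypic_components_def by (smt (verit) Collect_cong Collect_mem_eq)
qed

lemma multiplicity_in_isotypic_component:
  assumes Y: "subrep \<Gamma> \<rho> U Y" "irreducible_rep \<Gamma> \<rho> Y"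
  shows "multiplicity_in \<Gamma> \<rho> Y \<rho> (isotypic_component \<Gamma> \<rho> Y \<rho> U) = 1"
proof -
  have sY: "subrep \<Gamma> \<rho> UNIV Y" using Y(2) by (rule irreducible_subrep)
  have "{X \<in> irreducibles Y. rep_iso \<Gamma> \<rho> X \<rho> Y} = {Y}"
  proof (intro equalityI subsetI)
    fix X assume X: "X \<in> {X \<in> irreducibles Y. rep_iso \<Gamma> \<rho> X \<rho> Y}"
    then have "subrep \<Gamma> \<rho> UNIV X" by (auto simp: irreducibles_def irreducible_subrep)
    then show "X \<in> {Y}" using X rep_iso_imp_eq[OF _ sY _ rep_iso_refl] by auto
  qed (use Y rep_iso_refl in \<open>auto simp: irreducibles_def\<close>)
  then show ?thesis
    by (simp add: isotypic_component_eq[OF Y(1)] multiplicity_in_eq_card[OF sY])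
qed

text \<open>
  In the orthogonal decomposition of \<open>U\<close> the forms are simultaneously diagonal, so a vector enters
  only through the squared lengths of its components, and these can be prescribed independently.
\<close>

lemma polyhedral_cone_commuting_forms:
  fixes A :: "'n::finite \<Rightarrow> 'v \<Rightarrow> 'v"
  assumes U: "subrep \<Gamma> \<rho> UNIV U"
    and A: "\<And>k. commuting (A k)" and sym: "\<And>k x y. x \<bullet> A k y = A k x \<bullet> y"
  shows "polyhedral_cone ((\<lambda>\<phi>. \<chi> k. \<phi> \<bullet> A k \<phi>) ` U)"
proof -
  let ?D = "irreducibles U"
  have "\<exists>\<mu>. \<forall>x\<in>X. A k x = \<mu> *\<^sub>R x" if "X \<in> ?D" for X k
  proof (rule symmetric_commuting_scalar[OF _ A sym])
    show irr: "irreducible_rep \<Gamma> \<rho> X" using that by (simp add: irreducibles_def)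
    show "A k x \<in> X" if "x \<in> X" for x
      using commuting_preserves[OF A irreducible_subrep[OF irr] that] .
  qed
  then obtain \<mu> where \<mu>: "\<And>X k x. X \<in> ?D \<Longrightarrow> x \<in> X \<Longrightarrow> A k x = \<mu> X k *\<^sub>R x" by metis
  define v where "v X = (\<chi> k. \<mu> X k)" for X
  have val: "(\<chi> k. \<phi> \<bullet> A k \<phi>) = (\<Sum>X\<in>?D. (norm (f X))\<^sup>2 *\<^sub>R v X)"
    if f: "\<And>X. X \<in> ?D \<Longrightarrow> f X \<in> X" and \<phi>: "\<phi> = (\<Sum>X\<in>?D. f X)" for f \<phi>
  proof -
    have "\<phi> \<bullet> A k \<phi> = (\<Sum>X\<in>?D. (norm (f X))\<^sup>2 * \<mu> X k)" for k
    proof -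
      have "linear (A k)" using A by (simp add: commuting_def)
      then have "A k \<phi> = (\<Sum>X\<in>?D. \<mu> X k *\<^sub>R f X)"
        unfolding \<phi> by (simp add: linear_sum \<mu> f)
      then have "\<phi> \<bullet> A k \<phi> = (\<Sum>X\<in>?D. \<mu> X k * (\<phi> \<bullet> f X))"
        by (simp add: inner_sum_right)
      also have "\<dots> = (\<Sum>X\<in>?D. (norm (f X))\<^sup>2 * \<mu> X k)"
        using sum_in_subspace_inner[of U f, OF f _ f]
        by (intro sum.cong) (simp_all add: \<phi> power2_norm_eq_inner)
      finally show ?thesis .
    qed
    then show ?thesis by (simp add: vec_eq_iff v_def)
  qed
  have "(\<lambda>\<phi>. \<chi> k. \<phi> \<bullet> A k \<phi>) ` U = {\<Sum>X\<in>?D. c X *\<^sub>R v X | c. \<forall>X\<in>?D. 0 \<le> c X}"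
  proof (intro equalityI subsetI)
    fix w assume "w \<in> (\<lambda>\<phi>. \<chi> k. \<phi> \<bullet> A k \<phi>) ` U"
    then obtain \<phi> where \<phi>: "\<phi> \<in> U" "w = (\<chi> k. \<phi> \<bullet> A k \<phi>)" by blast
    have "w = (\<Sum>X\<in>?D. (norm (oproj X \<phi>))\<^sup>2 *\<^sub>R v X)"
      unfolding \<phi>(2)
      by (rule val) (simp_all add: oproj_in irreducibles_subspace sum_oproj_irreducibles[OF U \<phi>(1)])
    then show "w \<in> {\<Sum>X\<in>?D. c X *\<^sub>R v X | c. \<forall>X\<in>?D. 0 \<le> c X}" by fastforce
  next
    fix w assume "w \<in> {\<Sum>X\<in>?D. c X *\<^sub>R v X | c. \<forall>X\<in>?D. 0 \<le> c X}"
    then obtain c where c: "\<forall>X\<in>?D. 0 \<le> c X" and w: "w = (\<Sum>X\<in>?D. c X *\<^sub>R v X)" by blast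
    have "\<exists>x\<in>X. norm x = sqrt (c X)" if X: "X \<in> ?D" for X
    proof -
      have sX: "subspace X" using X by (rule irreducibles_subspace)
      obtain y where y: "y \<in> X" "y \<noteq> 0"
        using X sX by (auto simp: irreducibles_def irreducible_rep_def dest: subspace_0)
      have "(sqrt (c X) / norm y) *\<^sub>R y \<in> X" using y sX by (simp add: subspace_scale)
      moreover have "norm ((sqrt (c X) / norm y) *\<^sub>R y) = sqrt (c X)" using y c X by simp
      ultimately show ?thesis by blast
    qed
    then obtain f where f: "\<And>X. X \<in> ?D \<Longrightarrow> f X \<in> X \<and> norm (f X) = sqrt (c X)" by metis
    define \<phi> where "\<phi> = (\<Sum>X\<in>?D. f X)"
    have "\<phi> \<in> U"
      unfolding \<phi>_def using f subrep_subspace[OF U]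
      by (intro subspace_sum) (auto simp: irreducibles_def)
    moreover have "w = (\<chi> k. \<phi> \<bullet> A k \<phi>)"
      unfolding w using f c by (subst val[OF _ \<phi>_def]) auto
    ultimately show "w \<in> (\<lambda>\<phi>. \<chi> k. \<phi> \<bullet> A k \<phi>) ` U" by blast
  qed
  then show ?thesis using polyhedral_cone_indexed[of ?D v, OF finite_irreducibles] by simp
qed

end

section \<open>The regular representation of a finite abelian group\<close>

locale finite_comm_group_on_type = comm_group \<Gamma>
  for \<Gamma> :: "('a::finite, 'm) monoid_scheme" (structure) +
  assumes carrier_UNIV: "carrier \<Gamma> = UNIV"
begin

lemma in_carrier [simp]: "g \<in> carrier \<Gamma>"
  by (simp add: carrier_UNIV)

lemma bij_mult_left: "bij (\<lambda>g. h \<otimes> g)"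
  by (rule o_bij[of "\<lambda>g. inv h \<otimes> g"]) (auto simp: fun_eq_iff simp flip: m_assoc)

lemma translate_nth: "translate \<Gamma> h \<phi> $ g = \<phi> $ (inv h \<otimes> g)"
  by (simp add: translate_def)

lemma translate_axis: "translate \<Gamma> h (axis g 1) = axis (h \<otimes> g) 1"
proof -
  have "inv h \<otimes> x = g \<longleftrightarrow> x = h \<otimes> g" for x
    using inv_solve_left[of h g x] by (metis in_carrier inv_solve_left')
  then show ?thesis by (simp add: vec_eq_iff translate_nth axis_def)
qed

lemma translate_orthogonal_rep: "orthogonal_rep \<Gamma> (translate \<Gamma>)"
proof (intro orthogonal_rep.intro orthogonal_rep_axioms.intro is_group)
  fix g h :: 'a and x y :: "real ^ 'a"
  show "linear (translate \<Gamma> g)"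
    by (rule linearI) (simp_all add: vec_eq_iff translate_nth)
  show "translate \<Gamma> \<one> x = x" by (simp add: vec_eq_iff translate_nth)
  show "translate \<Gamma> (g \<otimes> h) x = translate \<Gamma> g (translate \<Gamma> h x)"
    by (simp add: vec_eq_iff translate_nth inv_mult_group m_assoc)
  show "translate \<Gamma> g x \<bullet> translate \<Gamma> g y = x \<bullet> y"
    unfolding inner_vec_def translate_nth
    by (rule sum.reindex_bij_betw[OF bij_mult_left])
qed

sublocale translation: orthogonal_rep \<Gamma> "translate \<Gamma>"
  by (rule translate_orthogonal_rep)

text \<open>
  By linearity and equivariance, \<open>A\<close> is convolution with \<open>a = A \<delta>\<^sub>1\<close>. Commutativity turns
  convolution into a combination of left translations, rather than right ones.
\<close>

lemma commuting_with_translate: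
  assumes "translation.commuting A"
  shows "A \<phi> = (\<Sum>h\<in>UNIV. A (axis \<one> 1) $ h *\<^sub>R translate \<Gamma> h \<phi>)"
proof -
  let ?\<delta> = "\<lambda>g::'a. axis g (1::real)"
  have lin: "linear A" and com: "\<And>g x. A (translate \<Gamma> g x) = translate \<Gamma> g (A x)"
    using assms by (auto simp: translation.commuting_def)
  have expand: "\<psi> = (\<Sum>g\<in>UNIV. \<psi> $ g *\<^sub>R ?\<delta> g)" for \<psi> :: "real ^ 'a"
    using basis_expansion[of \<psi>] by (simp add: scalar_mult_eq_scaleR)
  define B where "B \<psi> = (\<Sum>h\<in>UNIV. A (?\<delta> \<one>) $ h *\<^sub>R translate \<Gamma> h \<psi>)" for \<psi>
  have lB: "linear B" unfolding B_def
    by (intro linear_compose_sum ballI linear_compose_scale_right translation.linear_rho) simp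
  have A\<delta>: "A (?\<delta> g) = B (?\<delta> g)" for g
  proof -
    have lg: "linear (translate \<Gamma> g)" by (rule translation.linear_rho) simp
    have "A (?\<delta> g) = translate \<Gamma> g (A (?\<delta> \<one>))"
      using com[of g "?\<delta> \<one>"] by (simp add: translate_axis)
    also have "\<dots> = translate \<Gamma> g (\<Sum>h\<in>UNIV. A (?\<delta> \<one>) $ h *\<^sub>R ?\<delta> h)"
      by (simp only: expand[symmetric])
    also have "\<dots> = B (?\<delta> g)"
      by (simp add: B_def linear_sum[OF lg] linear_scale[OF lg] translate_axis m_comm[of g])
    finally show ?thesis .
  qed
  have "A \<phi> = A (\<Sum>g\<in>UNIV. \<phi> $ g *\<^sub>R ?\<delta> g)"
    by (simp only: expand[symmetric])
  also have "\<dots> = (\<Sum>g\<in>UNIV. \<phi> $ g *\<^sub>R A (?\<delta> g))"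
    by (simp only: linear_sum[OF lin] linear_scale[OF lin])
  also have "\<dots> = B (\<Sum>g\<in>UNIV. \<phi> $ g *\<^sub>R ?\<delta> g)"
    by (simp only: linear_sum[OF lB] linear_scale[OF lB] A\<delta>)
  also have "\<dots> = B \<phi>" by (simp only: expand[symmetric])
  finally show ?thesis by (simp only: B_def)
qed

sublocale translation: multiplicity_free_rep \<Gamma> "translate \<Gamma>"
proof unfold_locales
  fix A X x
  assume A: "translation.commuting A" and X: "subrep \<Gamma> (translate \<Gamma>) UNIV X" and x: "x \<in> X"
  show "A x \<in> X"
    unfolding commuting_with_translate[OF A, of x]
    using translation.subrep_subspace[OF X] translation.subrep_rho[OF X _ x]
    by (intro subspace_sum subspace_scale) simp_all
qed

section \<open>Laplacians of translation invariant edge sets\<close>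

lemma edge_sq_translate:
  assumes "\<exists>u v. e = {u, v}"
  shows "edge_sq (translate \<Gamma> h \<phi>) ((\<lambda>g. h \<otimes> g) ` e) = edge_sq \<phi> e"
  using assms by (auto simp: edge_sq_eq translate_nth simp flip: m_assoc)

lemma laplacian_form:
  fixes F :: "'a set set"
  assumes "\<And>e. e \<in> F \<Longrightarrow> \<exists>u v. e = {u, v}"
  shows "x \<bullet> (laplacian F *v y) = (laplacian F *v x) \<bullet> y"
    and "x \<bullet> (laplacian F *v x) = (\<Sum>e\<in>F. edge_sq x e)"
proof -
  have L: "transpose (laplacian F) = laplacian F
      \<and> (\<forall>\<phi>. \<phi> \<bullet> (laplacian F *v \<phi>) = (\<Sum>e\<in>F. edge_sq \<phi> e))"
    unfolding laplacian_def by (rule theI'[OF laplacian_ex1[OF assms]])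
  then show "x \<bullet> (laplacian F *v x) = (\<Sum>e\<in>F. edge_sq x e)" by blast
  show "x \<bullet> (laplacian F *v y) = (laplacian F *v x) \<bullet> y"
    using L dot_lmul_matrix[of x "laplacian F" y] by (metis transpose_matrix_vector)
qed

text \<open>
  The quadratic form of an invariant edge set is invariant; by polarisation so is its bilinear form,
  and for orthogonal translations this says that the matrix commutes with them.
\<close>

lemma commuting_laplacian:
  fixes F :: "'a set set"
  assumes pairs: "\<And>e. e \<in> F \<Longrightarrow> \<exists>u v. e = {u, v}"
    and inv: "\<And>h e. e \<in> F \<Longrightarrow> (\<lambda>g. h \<otimes> g) ` e \<in> F"
  shows "translation.commuting ((*v) (laplacian F))"
  unfolding translation.commuting_def
proof (intro conjI ballI allI)
  show "linear ((*v) (laplacian F))" by (rule matrix_vector_mul_linear)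
  let ?L = "(*v) (laplacian F)"
  fix h y
  let ?T = "translate \<Gamma> h"
  have lT: "linear ?T" by (rule translation.linear_rho) simp
  have q: "?T x \<bullet> ?L (?T x) = x \<bullet> ?L x" for x
  proof -
    let ?m = "\<lambda>e. (\<lambda>g. h \<otimes> g) ` e"
    have inj: "inj_on ?m F"
      using bij_mult_left[of h] by (auto intro!: inj_onI simp: bij_def inj_image_eq_iff)
    have "?m ` F = F"
      by (rule card_subset_eq) (use inv card_image[OF inj] in auto)
    then have "(\<Sum>e\<in>F. edge_sq (?T x) e) = (\<Sum>e\<in>F. edge_sq (?T x) (?m e))"
      using sum.reindex[OF inj, of "edge_sq (?T x)"] by simp
    also have "\<dots> = (\<Sum>e\<in>F. edge_sq x e)"
      by (intro sum.cong refl edge_sq_translate pairs)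
    finally show ?thesis by (simp add: laplacian_form(2)[OF pairs])
  qed
  have polar: "?T x \<bullet> ?L (?T y) = x \<bullet> ?L y" for x
  proof -
    have pol: "(a + b) \<bullet> ?L (a + b) = a \<bullet> ?L a + b \<bullet> ?L b + 2 * (a \<bullet> ?L b)" for a b
      using laplacian_form(1)[of F a b, OF pairs]
      by (simp add: matrix_vector_right_distrib inner_add_left inner_add_right inner_commute)
    show ?thesis
      using q[of "x + y"] q[of x] q[of y] pol[of x y] pol[of "?T x" "?T y"]
      by (simp add: linear_add[OF lT])
  qed
  have "z \<bullet> ?L (?T y) = z \<bullet> ?T (?L y)" for z
  proof -
    have z: "z = ?T (translate \<Gamma> (inv h) z)" by (simp add: translation.rho_inv)
    have "z \<bullet> ?L (?T y) = translate \<Gamma> (inv h) z \<bullet> ?L y" by (metis z polar)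
    also have "\<dots> = z \<bullet> ?T (?L y)"
      by (metis z translation.rho_inner in_carrier)
    finally show ?thesis .
  qed
  then show "?L (?T y) = ?T (?L y)" by (metis vector_eq_rdot inner_commute)
qed

lemma cay_edges_pairs: "e \<in> cay_edges \<Gamma> S \<Longrightarrow> \<exists>u v. e = {u, v}"
  by (auto simp: cay_edges_def)

lemma cay_edges_invariant: "e \<in> cay_edges \<Gamma> S \<Longrightarrow> (\<lambda>g. h \<otimes> g) ` e \<in> cay_edges \<Gamma> S"
  unfolding cay_edges_def by (auto simp flip: m_assoc) blast

lemma edge_orbit_invariant:
  assumes "F \<in> edge_orbits \<Gamma> S" "e \<in> F"
  shows "(\<lambda>g. h \<otimes> g) ` e \<in> F"
proof -
  obtain e0 where F: "F = {(\<lambda>g. k \<otimes> g) ` e0 | k. k \<in> carrier \<Gamma>}"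
    using assms(1) unfolding edge_orbits_def orbits_def orbit_def by blast
  then obtain k where "e = (\<lambda>g. k \<otimes> g) ` e0" using assms(2) by blast
  then have "(\<lambda>g. h \<otimes> g) ` e = (\<lambda>g. (h \<otimes> k) \<otimes> g) ` e0"
    by (simp add: image_image m_assoc)
  then show ?thesis unfolding F using in_carrier by blast
qed

lemma edge_orbit_pairs:
  assumes "F \<in> edge_orbits \<Gamma> S" "e \<in> F"
  shows "\<exists>u v. e = {u, v}"
  using assms cay_edges_invariant cay_edges_pairs
  unfolding edge_orbits_def orbits_def orbit_def by blast

lemma subrep_eigenspace_laplacian:
  "subrep \<Gamma> (translate \<Gamma>) UNIV (eigenspace (laplacian (cay_edges \<Gamma> S)) l)"
proof -
  have "subrep \<Gamma> (translate \<Gamma>) UNIV {x\<in>UNIV. laplacian (cay_edges \<Gamma> S) *v x = l *\<^sub>R x}"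
    using commuting_laplacian[OF cay_edges_pairs cay_edges_invariant]
    by (intro translation.subrep_eigenspace) (auto simp: subrep_def)
  then show ?thesis by (simp add: eigenspace_def)
qed

lemma polyhedral_cone_ell:
  assumes U: "subrep \<Gamma> (translate \<Gamma>) UNIV U"
  shows "polyhedral_cone (ell \<Gamma> S ` U)"
proof -
  define A where "A k \<phi> = (if k \<in> edge_orbits \<Gamma> S then laplacian k *v \<phi> else 0)"
    for k :: "'a set set" and \<phi> :: "real ^ 'a"
  have com: "translation.commuting (A k)" for k
  proof (cases "k \<in> edge_orbits \<Gamma> S")
    case True
    then have "A k = (*v) (laplacian k)" by (simp add: A_def fun_eq_iff)
    then show ?thesis
      using commuting_laplacian[OF edge_orbit_pairs edge_orbit_invariant, OF True _ True] by simp
  next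
    case False
    then have "A k = (\<lambda>_. 0)" by (simp add: A_def fun_eq_iff)
    then show ?thesis
      by (simp add: translation.commuting_def linear_zero linear_0[OF translation.linear_rho])
  qed
  have sym: "x \<bullet> A k y = A k x \<bullet> y" for k x y
    using laplacian_form(1)[OF edge_orbit_pairs] by (simp add: A_def)
  have "ell \<Gamma> S = (\<lambda>\<phi>. \<chi> k. \<phi> \<bullet> A k \<phi>)"
    using laplacian_form(2)[OF edge_orbit_pairs] by (simp add: fun_eq_iff ell_def A_def vec_eq_iff)
  then show ?thesis
    using translation.polyhedral_cone_commuting_forms[of U A, OF U com sym] by simp
qed

end

section \<open>Eigenspaces of abelian Cayley graphs\<close>

theorem theorem7p4:
  fixes \<Gamma> :: "('a::finite, 'm) monoid_scheme" and S :: "'a set" and l :: real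
  assumes "comm_group \<Gamma>" and "carrier \<Gamma> = UNIV"
    and "S \<subseteq> carrier \<Gamma>" and "generate \<Gamma> S = carrier \<Gamma>"
    and "\<And>s. s \<in> S \<Longrightarrow> inv\<^bsub>\<Gamma>\<^esub> s \<in> S" and "\<one>\<^bsub>\<Gamma>\<^esub> \<notin> S"
    and "is_eigenvalue (laplacian (cay_edges \<Gamma> S)) l" and "l > 0"
  defines "E \<equiv> eigenspace (laplacian (cay_edges \<Gamma> S)) l"
  shows "is_direct_sum E (isotypic_components \<Gamma> (translate \<Gamma>) E)
    \<and> (\<forall>Y. subrep \<Gamma> (translate \<Gamma>) E Y \<and> irreducible_rep \<Gamma> (translate \<Gamma>) Y \<longrightarrow>
         multiplicity_in \<Gamma> (translate \<Gamma>) Y (translate \<Gamma>)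
           (isotypic_component \<Gamma> (translate \<Gamma>) Y (translate \<Gamma>) E) = 1)
    \<and> (\<forall>(\<sigma> :: 'a \<Rightarrow> 'w \<Rightarrow> 'w) (W :: 'w::real_vector set). irreducible_rep \<Gamma> \<sigma> W \<longrightarrow>
         multiplicity_in \<Gamma> \<sigma> W (translate \<Gamma>) E \<le> 1)
    \<and> polyhedral_cone (ell \<Gamma> S ` E)"
proof -
  interpret finite_comm_group_on_type \<Gamma>
    using assms(1,2)
    by (intro finite_comm_group_on_type.intro finite_comm_group_on_type_axioms.intro)
  have E: "subrep \<Gamma> (translate \<Gamma>) UNIV E"
    unfolding E_def by (rule subrep_eigenspace_laplacian)
  show ?thesis
    using translation.is_direct_sum_irreducibles[OF E]
      translation.multiplicity_in_isotypic_component translation.multiplicity_in_le_1[OF E]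
      polyhedral_cone_ell[OF E]
    by (auto simp: translation.isotypic_components_eq)
qed

end
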